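(* Let $n\ge 2$, let $G$ be an open set in $\mathbb{R}^n$ and let $0<\delta<1$. If $D\subset\subset G$ is an open set such that $\mathcal{H}^{n-\delta}(\partial D)=0$, then $$\mathrm{cap}_{\delta,1}(\overline{D},G)\le 2P_\delta(D,G).$$
   Context: $D\subset\subset G$ means that the closure $\overline{D}$ is a compact subset of $G$. $\mathcal{H}^{s}$ denotes the $s$-dimensional Hausdorff measure in $\mathbb{R}^n$. $C_0(G)$ is the family of all continuous functions $u:G\to\mathbb{R}$ with compact support in $G$. For a compact set $K\subset G$, the fractional $(\delta,1)$-capacity is $$\mathrm{cap}_{\delta,1}(K,G)=\inf_u \int_G\int_G\frac{|u(x)-u(y)|}{|x-y|^{n+\delta}}\,dy\,dx,$$ where the infimum is taken over all $u\in C_0(G)$ such that $u(x)\ge 1$ for each $x\in K$. For a measurable set $A\subset G$, the fractional $\delta$-perimeter of $A$ with respect to $G$ is $$P_\delta(A,G)=\int_A\int_{G\setminus A}\frac{1}{|x-y|^{n+\delta}}\,dy\,dx\in[0,\infty].$$ *)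

theory Defs
  imports "HOL-Analysis.Analysis"
begin

definition compactly_contained :: "'a::topological_space set \<Rightarrow> 'a set \<Rightarrow> bool" where
  "compactly_contained D G \<longleftrightarrow> compact (closure D) \<and> closure D \<subseteq> G"

(* Hausdorff measure without a normalising constant (null sets do not depend on it).
   Covering sets must be bounded, because the library gives every unbounded set diameter 0.
   The case s = 0 is separate because 0 powr 0 = 0 in the library. *)
definition hausdorff_gauge :: "real \<Rightarrow> 'a::metric_space set \<Rightarrow> ennreal" where
  "hausdorff_gauge s U =
     (if U = {} then 0 else if s = 0 then 1 else ennreal (diameter U powr s))"

definition hausdorff_measure :: "real \<Rightarrow> 'a::metric_space set \<Rightarrow> ennreal" where
  "hausdorff_measure s E =
     (SUP r \<in> {0<..}.
        INF U \<in> {U :: nat \<Rightarrow> 'a set.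
                   E \<subseteq> (\<Union>i. U i) \<and> (\<forall>i. bounded (U i) \<and> diameter (U i) \<le> r)}.
          (\<Sum>i. hausdorff_gauge s (U i)))"

(* Functions on G are total functions whose values outside G are never used. *)
definition C0 :: "'a::topological_space set \<Rightarrow> ('a \<Rightarrow> real) set" where
  "C0 G = {u. continuous_on G u \<and> compactly_contained {x \<in> G. u x \<noteq> 0} G}"

(* The quotient at x = y is 0 / 0 = 0; the diagonal is a null set. *)
definition frac_cap :: "real \<Rightarrow> (real^'n) set \<Rightarrow> (real^'n) set \<Rightarrow> ennreal" where
  "frac_cap \<delta> K G =
     (INF u \<in> {u \<in> C0 G. \<forall>x\<in>K. u x \<ge> 1}.
        \<integral>\<^sup>+x\<in>G. (\<integral>\<^sup>+y\<in>G.
           ennreal (\<bar>u x - u y\<bar> / norm (x - y) powr (real CARD('n) + \<delta>)) \<partial>lebesgue) \<partial>lebesgue)"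

definition frac_perimeter :: "real \<Rightarrow> (real^'n) set \<Rightarrow> (real^'n) set \<Rightarrow> ennreal" where
  "frac_perimeter \<delta> A G =
     (\<integral>\<^sup>+x\<in>A. (\<integral>\<^sup>+y\<in>G - A.
        ennreal (1 / norm (x - y) powr (real CARD('n) + \<delta>)) \<partial>lebesgue) \<partial>lebesgue)"

end

theory Submission
  imports Defs
begin

text \<open>
  Since \<open>\<partial>D\<close> is compact and \<open>\<H>\<^sup>n\<^sup>-\<^sup>\<delta>\<close>-null, it is covered by finitely many balls \<open>B(c\<^sub>i, R\<^sub>i)\<close> with
  \<open>\<Sum> R\<^sub>i\<^sup>n\<^sup>-\<^sup>\<delta>\<close> arbitrarily small. Let \<open>w\<^sub>i\<close> be the Lipschitz cutoff equal to \<open>1\<close> on \<open>B(c\<^sub>i, R\<^sub>i)\<close> and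
  vanishing off \<open>B(c\<^sub>i, 2R\<^sub>i)\<close>. The function \<open>u = min 1 (1\<^sub>D + \<Sum> w\<^sub>i)\<close> is already continuous, without
  mollification: the indicator jumps only on \<open>\<partial>D\<close>, near which \<open>u = 1\<close>. Its seminorm is at most that
  of \<open>1\<^sub>D\<close>, which is \<open>2 P\<^sub>\<delta>(D, G)\<close>, plus \<open>\<Sum> [w\<^sub>i] \<le> C \<Sum> R\<^sub>i\<^sup>n\<^sup>-\<^sup>\<delta>\<close>.
\<close>

section \<open>Finite ball covers of compact Hausdorff-null sets\<close>

lemma le_suminf_ennreal:
  fixes f :: "nat \<Rightarrow> ennreal"
  shows "f k \<le> suminf f"
  using sum_le_suminf[of f "{k}"] by simp

text \<open>Nullity supplies covering sets of small total gauge. Each set that meets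
  \<open>E\<close> lies in a ball centred at one of its points in \<open>E\<close>, of radius
  comparable to its diameter. Padding by \<open>\<eta> i > 0\<close> keeps the radius positive when
  the diameter is 0, so the balls are open and compactness leaves finitely many; the padding itself
  costs only a geometric series.\<close>

lemma hausdorff_null_ball_cover:
  fixes E :: "'a::metric_space set"
  assumes "compact E" "hausdorff_measure s E = 0" "0 < s" "0 < e" "0 < r"
  obtains I :: "nat set" and c :: "nat \<Rightarrow> 'a" and R :: "nat \<Rightarrow> real"
  where "finite I" "\<And>i. i \<in> I \<Longrightarrow> c i \<in> E \<and> 0 < R i \<and> R i \<le> r"
    "E \<subseteq> (\<Union>i\<in>I. ball (c i) (R i))" "(\<Sum>i\<in>I. R i powr s) \<le> e"
proof -
  \<comment> \<open>The diameters and the padding each cost at most \<open>\<epsilon>\<close>, and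
    doubling the radii costs the factor \<open>2 powr s\<close>; together this is exactly
    \<open>e\<close>.\<close>
  define \<epsilon> where "\<epsilon> = e / (2 * 2 powr s)"
  have \<epsilon>: "\<epsilon> > 0" using assms by (simp add: \<epsilon>_def)
  let ?F = "{U :: nat \<Rightarrow> 'a set. E \<subseteq> (\<Union>i. U i) \<and> (\<forall>i. bounded (U i) \<and> diameter (U i) \<le> r / 2)}"
  have "(INF U \<in> ?F. (\<Sum>i. hausdorff_gauge s (U i))) \<le> hausdorff_measure s E"
    unfolding hausdorff_measure_def using \<open>0 < r\<close> by (intro SUP_upper) auto
  also have "\<dots> < ennreal \<epsilon>" using assms \<epsilon> by simp
  finally obtain U where U: "E \<subseteq> (\<Union>i. U i)" "\<And>i. bounded (U i)" "\<And>i. diameter (U i) \<le> r / 2"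
    and Usum: "(\<Sum>i. hausdorff_gauge s (U i)) < ennreal \<epsilon>"
    by (auto simp: INF_less_iff)
  \<comment> \<open>The root makes \<open>\<eta> i powr s\<close> at most the \<open>i\<close>-th
    term of a series with sum \<open>\<epsilon>\<close>; the cap \<open>r / 2\<close> yields
    \<open>R i \<le> r\<close>.\<close>
  define \<eta> where "\<eta> i = min (r / 2) ((\<epsilon> * (1/2) ^ Suc i) powr (1 / s))" for i
  \<comment> \<open>The factor 2 makes \<open>diameter (U i) < R i\<close> strict, so that the open
    ball about a point of \<open>U i\<close> contains all of \<open>U i\<close>.\<close>
  define R where "R i = 2 * max (diameter (U i)) (\<eta> i)" for i
  define c where "c i = (SOME x. x \<in> U i \<inter> E)" for i
  define J where "J = {i. U i \<inter> E \<noteq> {}}"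
  have c: "c i \<in> U i \<inter> E" if "i \<in> J" for i
    using that someI_ex[of "\<lambda>x. x \<in> U i \<inter> E"] unfolding J_def c_def by blast
  have \<eta>: "0 < \<eta> i" for i using \<open>0 < r\<close> \<epsilon> by (simp add: \<eta>_def)
  have R: "0 < R i" "R i \<le> r" for i
    using \<eta>[of i] U(3)[of i] by (simp_all add: R_def less_max_iff_disj) (simp add: \<eta>_def)
  have "E \<subseteq> (\<Union>i\<in>J. ball (c i) (R i))"
  proof
    fix x assume "x \<in> E"
    then obtain i where i: "x \<in> U i" using U by auto
    with \<open>x \<in> E\<close> have "i \<in> J" by (auto simp: J_def)
    have "dist (c i) x \<le> diameter (U i)"
      using U(2) c[OF \<open>i \<in> J\<close>] i by (intro diameter_bounded_bound) auto
    also have "\<dots> < R i" using \<eta>[of i] by (auto simp: R_def max_def)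
    finally show "x \<in> (\<Union>i\<in>J. ball (c i) (R i))" using \<open>i \<in> J\<close> by auto
  qed
  then obtain I where I: "I \<subseteq> J" "finite I" "E \<subseteq> (\<Union>i\<in>I. ball (c i) (R i))"
    by (rule compactE_image[OF \<open>compact E\<close> open_ball])
  have Rs: "R i powr s \<le> 2 powr s * (diameter (U i) powr s + \<epsilon> * (1/2) ^ Suc i)" for i
  proof -
    have "\<eta> i powr s \<le> ((\<epsilon> * (1/2) ^ Suc i) powr (1 / s)) powr s"
      using \<eta>[of i] \<open>0 < s\<close> by (intro powr_mono2) (auto simp: \<eta>_def)
    also have "\<dots> = \<epsilon> * (1/2) ^ Suc i" using \<epsilon> \<open>0 < s\<close> by (simp add: powr_powr)
    finally have "\<eta> i powr s \<le> \<epsilon> * (1/2) ^ Suc i" .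
    then have "max (diameter (U i)) (\<eta> i) powr s \<le> diameter (U i) powr s + \<epsilon> * (1/2) ^ Suc i"
      using \<epsilon> by (auto simp: max_def intro: add_increasing add_increasing2)
    then show ?thesis
      using \<eta>[of i] by (simp add: R_def powr_mult)
  qed
  have diam_sum: "(\<Sum>i\<in>I. diameter (U i) powr s) \<le> \<epsilon>"
  proof -
    have "ennreal (\<Sum>i\<in>I. diameter (U i) powr s) = (\<Sum>i\<in>I. ennreal (diameter (U i) powr s))"
      by (simp add: sum_ennreal)
    \<comment> \<open>Indices in \<open>J\<close> have nonempty \<open>U i\<close>, and
      \<open>s > 0\<close>, so the gauge takes its third branch.\<close>
    also have "\<dots> = (\<Sum>i\<in>I. hausdorff_gauge s (U i))"
      using I(1) \<open>0 < s\<close> by (intro sum.cong) (auto simp: hausdorff_gauge_def J_def)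
    also have "\<dots> \<le> (\<Sum>i. hausdorff_gauge s (U i))"
      using I(2) by (intro sum_le_suminf) auto
    also have "\<dots> \<le> ennreal \<epsilon>" using Usum by simp
    finally show ?thesis using \<epsilon> by (simp add: ennreal_le_iff)
  qed
  have geom: "(\<Sum>i\<in>I. (1/2::real) ^ Suc i) \<le> 1"
    using sum_le_suminf[OF sums_summable[OF power_half_series] I(2)] sums_unique[OF power_half_series]
    by simp
  have "(\<Sum>i\<in>I. R i powr s) \<le> (\<Sum>i\<in>I. 2 powr s * (diameter (U i) powr s + \<epsilon> * (1/2) ^ Suc i))"
    by (intro sum_mono Rs)
  also have "\<dots> = 2 powr s * ((\<Sum>i\<in>I. diameter (U i) powr s) + \<epsilon> * (\<Sum>i\<in>I. (1/2) ^ Suc i))"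
    by (simp only: sum.distrib sum_distrib_left distrib_left)
  also have "\<dots> \<le> 2 powr s * (\<epsilon> + \<epsilon> * 1)"
    using \<epsilon> by (intro mult_left_mono add_mono diam_sum geom) auto
  also have "\<dots> = e" by (simp add: \<epsilon>_def)
  finally show thesis
    using that[OF I(2) _ I(3)] c I(1) R by blast
qed

section \<open>The truncated kernel\<close>

text \<open>Dyadic annuli around \<open>x\<close>: the truncation makes the kernel integrable near \<open>x\<close> since \<open>\<delta> < 1\<close>.\<close>

lemma nn_integral_truncated_kernel:
  fixes \<delta> :: real
  assumes "0 < \<delta>" "\<delta> < 1"
  obtains K :: real where "0 \<le> K"
    "\<And>\<rho> (x :: 'a::euclidean_space). 0 < \<rho> \<Longrightarrow>
       (\<integral>\<^sup>+y. ennreal (min 1 (norm (x - y) / \<rho>) / norm (x - y) powr (real DIM('a) + \<delta>)) \<partial>lborel)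
         \<le> ennreal (K * \<rho> powr - \<delta>)"
proof -
  define n where "n = real DIM('a)"
  have n1: "1 \<le> n" using DIM_positive[where 'a='a] by (simp add: n_def Suc_le_eq)
  define V where "V = unit_ball_vol n"
  have V: "0 \<le> V" by (simp add: V_def n_def)
  \<comment> \<open>Up to the factor \<open>\<rho> powr - \<delta>\<close>, \<open>A k\<close> and
    \<open>B k\<close> bound the contribution of the \<open>k\<close>-th annulus outside and inside
    radius \<open>\<rho>\<close>. The ratios \<open>2 powr - \<delta>\<close> and
    \<open>2 powr (\<delta> - 1)\<close> are below 1 because \<open>0 < \<delta>\<close> and
    \<open>\<delta> < 1\<close> respectively.\<close>
  define A where "A k = V * 2 powr n * (2 powr - \<delta>) ^ k" for k :: nat
  define B where "B k = V * 2 powr (n + \<delta> - 1) * (2 powr (\<delta> - 1)) ^ k" for k :: nat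
  have sA: "summable A"
    unfolding A_def using \<open>0 < \<delta>\<close> by (intro summable_mult summable_geometric) (simp add: powr_less_one)
  have sB: "summable B"
    unfolding B_def using \<open>\<delta> < 1\<close> by (intro summable_mult summable_geometric) (simp add: powr_less_one)
  have AB0: "0 \<le> A k" "0 \<le> B k" for k using V by (auto simp: A_def B_def)
  define K where "K = suminf A + suminf B"
  have "0 \<le> K" unfolding K_def using sA sB AB0 by (intro add_nonneg_nonneg suminf_nonneg) auto
  moreover have "(\<integral>\<^sup>+y. ennreal (min 1 (norm (x - y) / \<rho>) / norm (x - y) powr (real DIM('a) + \<delta>)) \<partial>lborel)
         \<le> ennreal (K * \<rho> powr - \<delta>)" if "0 < \<rho>" for \<rho> and x :: 'a
  proof -
    \<comment> \<open>Both \<open>a k\<close> and \<open>b k\<close> evaluate a decreasing power of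
      the distance at the inner radius of an annulus. The annuli are then enlarged to the full balls
      \<open>?S k\<close> and \<open>?T k\<close>, whose volumes are explicit.\<close>
    define a where "a k = (2 powr real k * \<rho>) powr - (n + \<delta>)" for k :: nat
    define b where "b k = (2 powr - real (Suc k) * \<rho>) powr (1 - n - \<delta>) / \<rho>" for k :: nat
    let ?S = "\<lambda>k. cball x (2 powr real (Suc k) * \<rho>)"
    let ?T = "\<lambda>k. cball x (2 powr - real k * \<rho>)"
    have ptw: "ennreal (min 1 (norm (x - y) / \<rho>) / norm (x - y) powr (real DIM('a) + \<delta>))
      \<le> (\<Sum>k. ennreal (a k) * indicator (?S k) y) + (\<Sum>k. ennreal (b k) * indicator (?T k) y)" for y
    \<comment> \<open>On the diagonal the numerator is 0, hence so is the quotient.\<close>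
    proof (cases "x = y")
      case False
      define t where "t = norm (x - y)"
      have t: "0 < t" "dist x y = t" using False by (auto simp: t_def dist_norm)
      show ?thesis
      proof (cases "\<rho> \<le> t")
        case True
        \<comment> \<open>The dyadic scale of \<open>t\<close>: the integer part \<open>k\<close> of
          \<open>l\<close> places \<open>t\<close> between \<open>2 powr k * \<rho>\<close> and
          \<open>2 powr (Suc k) * \<rho>\<close>.\<close>
        define l where "l = log 2 (t / \<rho>)"
        have l: "0 \<le> l" using True \<open>0 < \<rho>\<close> t by (simp add: l_def)
        define k where "k = nat \<lfloor>l\<rfloor>"
        have k: "real k \<le> l" "l \<le> real (Suc k)" using l unfolding k_def by linarith+
        have tl: "t = 2 powr l * \<rho>" using \<open>0 < \<rho>\<close> t by (simp add: l_def)
        have "min 1 (t / \<rho>) / t powr (n + \<delta>) \<le> t powr - (n + \<delta>)"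
          unfolding powr_minus_divide by (intro divide_right_mono) auto
        also have "\<dots> \<le> a k"
          unfolding a_def using k \<open>0 < \<rho>\<close> n1 \<open>0 < \<delta>\<close> tl by (intro powr_mono2') auto
        finally have "ennreal (min 1 (t / \<rho>) / t powr (n + \<delta>)) \<le> ennreal (a k)" by (rule ennreal_leI)
        also have "\<dots> = ennreal (a k) * indicator (?S k) y"
          using k \<open>0 < \<rho>\<close> by (simp add: t tl)
        also have "\<dots> \<le> (\<Sum>k. ennreal (a k) * indicator (?S k) y)"
          by (rule le_suminf_ennreal)
        finally show ?thesis by (auto simp: t_def n_def intro: add_increasing2)
      next
        case False
        \<comment> \<open>With the sign reversed the inner radius belongs to \<open>Suc k\<close>
          and the outer one to \<open>k\<close>, which explains the shifted index in
          \<open>b\<close>.\<close>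
        define l where "l = - log 2 (t / \<rho>)"
        have l: "0 \<le> l" using False \<open>0 < \<rho>\<close> t by (simp add: l_def)
        define k where "k = nat \<lfloor>l\<rfloor>"
        have k: "real k \<le> l" "l \<le> real (Suc k)" using l unfolding k_def by linarith+
        have tl: "t = 2 powr - l * \<rho>" using \<open>0 < \<rho>\<close> t by (simp add: l_def)
        have "min 1 (t / \<rho>) / t powr (n + \<delta>) \<le> (t / \<rho>) / t powr (n + \<delta>)"
          using t by (intro divide_right_mono) auto
        also have "\<dots> = t powr (1 - n - \<delta>) / \<rho>"
          using t by (simp add: powr_diff powr_add divide_simps)
        also have "\<dots> \<le> b k"
          unfolding b_def using k \<open>0 < \<rho>\<close> n1 \<open>0 < \<delta>\<close> tl
          by (intro divide_right_mono powr_mono2') auto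
        finally have "ennreal (min 1 (t / \<rho>) / t powr (n + \<delta>)) \<le> ennreal (b k)" by (rule ennreal_leI)
        also have "\<dots> = ennreal (b k) * indicator (?T k) y"
          using k \<open>0 < \<rho>\<close> by (simp add: t tl)
        also have "\<dots> \<le> (\<Sum>k. ennreal (b k) * indicator (?T k) y)"
          by (rule le_suminf_ennreal)
        finally show ?thesis by (auto simp: t_def n_def intro: add_increasing)
      qed
    qed auto
    have intA: "(\<integral>\<^sup>+y. ennreal (a k) * indicator (?S k) y \<partial>lborel) = ennreal (A k * \<rho> powr - \<delta>)" for k
    proof -
      have "(\<integral>\<^sup>+y. ennreal (a k) * indicator (?S k) y \<partial>lborel)
          = ennreal (a k * (V * (2 powr real (Suc k) * \<rho>) powr n))"
        using \<open>0 < \<rho>\<close> V by (simp add: nn_integral_cmult_indicator emeasure_cball V_def n_def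
            powr_realpow ennreal_mult[symmetric] a_def)
      also have "a k * (V * (2 powr real (Suc k) * \<rho>) powr n) = A k * \<rho> powr - \<delta>"
      proof -
        \<comment> \<open>The powers of 2 and the powers of \<open>\<rho>\<close> are collected
          separately, each through its exponents.\<close>
        have regroup: "(w * x) * (V * (y * z)) = V * (w * y) * (x * z)" for w x y z by simp
        have "a k = 2 powr (- (n + \<delta>) * k) * \<rho> powr - (n + \<delta>)"
          using \<open>0 < \<rho>\<close> by (simp add: a_def powr_mult powr_powr mult.commute)
        moreover have "(2 powr real (Suc k) * \<rho>) powr n = 2 powr (n + n * k) * \<rho> powr n"
          using \<open>0 < \<rho>\<close> by (simp add: powr_mult powr_powr algebra_simps)
        moreover have "A k = V * 2 powr (n - \<delta> * k)"
          by (simp add: A_def powr_power powr_add[symmetric] algebra_simps)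
        moreover have "2 powr (- (n + \<delta>) * k) * 2 powr (n + n * k) = 2 powr (n - \<delta> * k)"
          by (simp add: powr_add[symmetric] algebra_simps)
        moreover have "\<rho> powr - (n + \<delta>) * \<rho> powr n = \<rho> powr - \<delta>"
          by (simp add: powr_add[symmetric])
        ultimately show ?thesis by (simp only: regroup)
      qed
      finally show ?thesis .
    qed
    have intB: "(\<integral>\<^sup>+y. ennreal (b k) * indicator (?T k) y \<partial>lborel) = ennreal (B k * \<rho> powr - \<delta>)" for k
    proof -
      have "(\<integral>\<^sup>+y. ennreal (b k) * indicator (?T k) y \<partial>lborel)
          = ennreal (b k * (V * (2 powr - real k * \<rho>) powr n))"
        using \<open>0 < \<rho>\<close> V by (simp add: nn_integral_cmult_indicator emeasure_cball V_def n_def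
            powr_realpow ennreal_mult[symmetric] b_def)
      also have "b k * (V * (2 powr - real k * \<rho>) powr n) = B k * \<rho> powr - \<delta>"
      proof -
        have regroup: "(w * x) * (V * (y * z)) = V * (w * y) * (x * z)" for w x y z by simp
        have "b k = 2 powr ((n + \<delta> - 1) * Suc k) * \<rho> powr - (n + \<delta>)"
        proof -
          have "b k = 2 powr (- real (Suc k) * (1 - n - \<delta>)) * (\<rho> powr (1 - n - \<delta>) / \<rho>)"
            using \<open>0 < \<rho>\<close> unfolding b_def by (subst powr_mult) (auto simp only: powr_powr times_divide_eq_right)
          also have "\<rho> powr (1 - n - \<delta>) / \<rho> = \<rho> powr - (n + \<delta>)"
            using \<open>0 < \<rho>\<close> powr_diff[of \<rho> "1 - n - \<delta>" 1] by (simp add: algebra_simps)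
          also have "- real (Suc k) * (1 - n - \<delta>) = (n + \<delta> - 1) * Suc k"
            by (simp add: algebra_simps)
          finally show ?thesis .
        qed
        moreover have "(2 powr - real k * \<rho>) powr n = 2 powr (- n * k) * \<rho> powr n"
          using \<open>0 < \<rho>\<close> by (simp add: powr_mult powr_powr algebra_simps)
        moreover have "B k = V * 2 powr (n + \<delta> - 1 + (\<delta> - 1) * k)"
          by (simp add: B_def powr_power powr_add[symmetric] algebra_simps)
        moreover have "2 powr ((n + \<delta> - 1) * Suc k) * 2 powr (- n * k) = 2 powr (n + \<delta> - 1 + (\<delta> - 1) * k)"
          by (simp add: powr_add[symmetric] algebra_simps)
        moreover have "\<rho> powr - (n + \<delta>) * \<rho> powr n = \<rho> powr - \<delta>"
          by (simp add: powr_add[symmetric])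
        ultimately show ?thesis by (simp only: regroup)
      qed
      finally show ?thesis .
    qed
    have series: "(\<lambda>y. \<Sum>k. ennreal (f k) * indicator (cball x (q k)) y) \<in> borel_measurable lborel"
      "(\<integral>\<^sup>+y. (\<Sum>k. ennreal (f k) * indicator (cball x (q k)) y) \<partial>lborel)
        = (\<Sum>k. \<integral>\<^sup>+y. ennreal (f k) * indicator (cball x (q k)) y \<partial>lborel)" for f q :: "nat \<Rightarrow> real"
    proof -
      have [measurable]: "(\<lambda>y. ennreal (f k) * indicator (cball x (q k)) y) \<in> borel_measurable lborel" for k
        by (intro borel_measurable_times_ennreal borel_measurable_indicator) auto
      show "(\<lambda>y. \<Sum>k. ennreal (f k) * indicator (cball x (q k)) y) \<in> borel_measurable lborel"
        by measurable
      show "(\<integral>\<^sup>+y. (\<Sum>k. ennreal (f k) * indicator (cball x (q k)) y) \<partial>lborel)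
        = (\<Sum>k. \<integral>\<^sup>+y. ennreal (f k) * indicator (cball x (q k)) y \<partial>lborel)"
        by (intro nn_integral_suminf) measurable
    qed
    have "(\<integral>\<^sup>+y. ennreal (min 1 (norm (x - y) / \<rho>) / norm (x - y) powr (real DIM('a) + \<delta>)) \<partial>lborel)
      \<le> (\<integral>\<^sup>+y. (\<Sum>k. ennreal (a k) * indicator (?S k) y) + (\<Sum>k. ennreal (b k) * indicator (?T k) y) \<partial>lborel)"
      by (intro nn_integral_mono ptw)
    also have "\<dots> = (\<Sum>k. \<integral>\<^sup>+y. ennreal (a k) * indicator (?S k) y \<partial>lborel)
        + (\<Sum>k. \<integral>\<^sup>+y. ennreal (b k) * indicator (?T k) y \<partial>lborel)"
      by (simp only: nn_integral_add[OF series(1) series(1)] series(2))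
    also have "\<dots> = (\<Sum>k. ennreal (A k * \<rho> powr - \<delta>)) + (\<Sum>k. ennreal (B k * \<rho> powr - \<delta>))"
      by (simp only: intA intB)
    also have "\<dots> = ennreal (K * \<rho> powr - \<delta>)"
      using sA sB AB0 by (simp add: K_def distrib_right suminf_ennreal2 suminf_nonneg
          summable_mult2 suminf_mult2[symmetric] ennreal_plus[symmetric] del: ennreal_plus)
    finally show ?thesis .
  qed
  ultimately show thesis using that by blast
qed

section \<open>The Gagliardo seminorm of sums, indicators and bumps\<close>

text \<open>The fractional Sobolev seminorm of order \<open>\<delta>\<close> and exponent 1.
  Integrating against \<open>lborel\<close> makes Fubini available for Borel integrands.\<close>

definition gagliardo :: "real \<Rightarrow> 'a::euclidean_space set \<Rightarrow> ('a \<Rightarrow> real) \<Rightarrow> ennreal" where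
  "gagliardo \<delta> G u =
     (\<integral>\<^sup>+x\<in>G. (\<integral>\<^sup>+y\<in>G.
        ennreal (\<bar>u x - u y\<bar> / norm (x - y) powr (real DIM('a) + \<delta>)) \<partial>lborel) \<partial>lborel)"

text \<open>\<open>u\<close> is admissible in the infimum, and completing the measure does not
  change a nonnegative integral.\<close>

lemma frac_cap_le_gagliardo:
  fixes G K :: "(real^'n) set"
  assumes "u \<in> C0 G" "\<And>x. x \<in> K \<Longrightarrow> 1 \<le> u x"
  shows "frac_cap \<delta> K G \<le> gagliardo \<delta> G u"
  unfolding frac_cap_def gagliardo_def nn_integral_completion
  using assms by (intro INF_lower2[of u]) auto

text \<open>For a fixed kernel the double integral is monotone and additive in the difference
  \<open>\<bar>u x - u y\<bar>\<close>, so a pointwise bound on differences passes to the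
  seminorms.\<close>

lemma gagliardo_le_add_sum:
  fixes u v :: "'a::euclidean_space \<Rightarrow> real"
  assumes [measurable]: "G \<in> sets borel" "v \<in> borel_measurable borel"
    "\<And>i. i \<in> I \<Longrightarrow> w i \<in> borel_measurable borel"
    and le: "\<And>x y. \<bar>u x - u y\<bar> \<le> \<bar>v x - v y\<bar> + (\<Sum>i\<in>I. \<bar>w i x - w i y\<bar>)"
  shows "gagliardo \<delta> G u \<le> gagliardo \<delta> G v + (\<Sum>i\<in>I. gagliardo \<delta> G (w i))"
proof -
  let ?f = "\<lambda>g x y. ennreal (\<bar>g x - g y\<bar> / norm (x - y) powr (real DIM('a) + \<delta>)) * indicator G y"
  have f_le: "?f u x y \<le> ?f v x y + (\<Sum>i\<in>I. ?f (w i) x y)" for x y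
  proof -
    let ?N = "norm (x - y) powr (real DIM('a) + \<delta>)"
    have "ennreal (\<bar>u x - u y\<bar> / ?N) \<le> ennreal ((\<bar>v x - v y\<bar> + (\<Sum>i\<in>I. \<bar>w i x - w i y\<bar>)) / ?N)"
      by (intro ennreal_leI divide_right_mono le) auto
    also have "\<dots> = ennreal (\<bar>v x - v y\<bar> / ?N) + (\<Sum>i\<in>I. ennreal (\<bar>w i x - w i y\<bar> / ?N))"
    proof -
      have "(\<Sum>i\<in>I. ennreal (\<bar>w i x - w i y\<bar> / ?N)) = ennreal ((\<Sum>i\<in>I. \<bar>w i x - w i y\<bar>) / ?N)"
        unfolding sum_divide_distrib by (rule sum_ennreal) simp
      then show ?thesis
        by (simp only: add_divide_distrib) (simp add: sum_nonneg)
    qed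
    finally show ?thesis
      by (auto split: split_indicator)
  qed
  have "gagliardo \<delta> G u \<le> (\<integral>\<^sup>+x. (\<integral>\<^sup>+y. ?f v x y + (\<Sum>i\<in>I. ?f (w i) x y) \<partial>lborel) * indicator G x \<partial>lborel)"
    unfolding gagliardo_def by (intro nn_integral_mono mult_right_mono f_le) auto
  also have "\<dots> = (\<integral>\<^sup>+x. (\<integral>\<^sup>+y. ?f v x y \<partial>lborel) * indicator G x
      + (\<Sum>i\<in>I. (\<integral>\<^sup>+y. ?f (w i) x y \<partial>lborel) * indicator G x) \<partial>lborel)"
    by (simp add: nn_integral_add nn_integral_sum distrib_right sum_distrib_right)
  also have "\<dots> = gagliardo \<delta> G v + (\<Sum>i\<in>I. gagliardo \<delta> G (w i))"
    unfolding gagliardo_def by (simp add: nn_integral_add nn_integral_sum)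
  finally show ?thesis .
qed

text \<open>The difference of indicators is 1 when exactly one of the two points lies in
  \<open>D\<close>, and 0 otherwise. By symmetry of the kernel the two cases contribute equally,
  whence the factor 2.\<close>

lemma gagliardo_indicator:
  fixes G D :: "(real^'n) set"
  assumes [measurable]: "G \<in> sets borel" "D \<in> sets borel" and "D \<subseteq> G"
  shows "gagliardo \<delta> G (indicator D) = 2 * frac_perimeter \<delta> D G"
proof -
  define k where "k x y = ennreal (1 / norm (x - y) powr (real CARD('n) + \<delta>))" for x y :: "real^'n"
  have k_meas [measurable]: "case_prod k \<in> borel_measurable (borel \<Otimes>\<^sub>M borel)"
    unfolding k_def by measurable
  have k_sym: "k x y = k y x" for x y by (simp add: k_def norm_minus_commute)
  have P: "frac_perimeter \<delta> D G = (\<integral>\<^sup>+x. \<integral>\<^sup>+y. k x y * indicator (G - D) y * indicator D x \<partial>lborel \<partial>lborel)"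
    unfolding frac_perimeter_def nn_integral_completion k_def[symmetric]
    by (simp add: nn_integral_multc)
  have "gagliardo \<delta> G (indicator D)
      = (\<integral>\<^sup>+x. \<integral>\<^sup>+y. ennreal (\<bar>indicator D x - indicator D y\<bar> / norm (x - y) powr (real CARD('n) + \<delta>))
           * indicator G y * indicator G x \<partial>lborel \<partial>lborel)"
    unfolding gagliardo_def by (simp add: nn_integral_multc)
  \<comment> \<open>Writing \<open>k y x\<close> in the second summand makes it the literal
    transpose of the first, as Fubini requires.\<close>
  also have "\<dots> = (\<integral>\<^sup>+x. \<integral>\<^sup>+y. k x y * indicator (G - D) y * indicator D x
      + k y x * indicator (G - D) x * indicator D y \<partial>lborel \<partial>lborel)"
  proof (intro nn_integral_cong)
    fix x y :: "real^'n"
    have "k y x = k x y" by (rule k_sym)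
    then show "ennreal (\<bar>indicator D x - indicator D y\<bar> / norm (x - y) powr (real CARD('n) + \<delta>))
           * indicator G y * indicator G x
        = k x y * indicator (G - D) y * indicator D x + k y x * indicator (G - D) x * indicator D y"
      using subsetD[OF \<open>D \<subseteq> G\<close>, of x] subsetD[OF \<open>D \<subseteq> G\<close>, of y]
      by (cases "x \<in> D"; cases "y \<in> D"; cases "x \<in> G"; cases "y \<in> G") (simp_all add: k_def)
  qed
  also have "\<dots> = frac_perimeter \<delta> D G
      + (\<integral>\<^sup>+x. \<integral>\<^sup>+y. k y x * indicator (G - D) x * indicator D y \<partial>lborel \<partial>lborel)"
    by (simp add: nn_integral_add P)
  also have "(\<integral>\<^sup>+x. \<integral>\<^sup>+y. k y x * indicator (G - D) x * indicator D y \<partial>lborel \<partial>lborel)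
      = frac_perimeter \<delta> D G"
    unfolding P by (rule lborel_pair.Fubini') measurable
  finally show ?thesis by (simp add: mult_2)
qed

text \<open>Only pairs with a point in the ball of radius \<open>2 * R\<close> contribute, and there
  the difference is at most \<open>min 1 (norm (x - y) / R)\<close>. The truncated kernel with
  \<open>\<rho> = R\<close> gives \<open>R powr - \<delta>\<close> for each such point, and the
  volume of the ball gives the remaining \<open>R powr n\<close>. Extending both integrals to the
  whole space makes \<open>C\<close> independent of \<open>G\<close>.\<close>

lemma gagliardo_bump_le:
  fixes \<delta> :: real
  assumes "0 < \<delta>" "\<delta> < 1"
  obtains C :: real where "0 < C"
    "\<And>G u R (a :: 'a::euclidean_space). 0 < R \<Longrightarrow> (\<And>x. 0 \<le> u x \<and> u x \<le> 1) \<Longrightarrow>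
       (\<And>x. x \<notin> cball a (2 * R) \<Longrightarrow> u x = 0) \<Longrightarrow> (\<And>x y. \<bar>u x - u y\<bar> \<le> norm (x - y) / R) \<Longrightarrow>
       gagliardo \<delta> G u \<le> ennreal (C * R powr (real DIM('a) - \<delta>))"
proof -
  define n where "n = real DIM('a)"
  define V where "V = unit_ball_vol n"
  have V: "0 \<le> V" by (simp add: V_def n_def)
  obtain K where K: "0 \<le> K" "\<And>\<rho> (x :: 'a). 0 < \<rho> \<Longrightarrow>
       (\<integral>\<^sup>+y. ennreal (min 1 (norm (x - y) / \<rho>) / norm (x - y) powr (real DIM('a) + \<delta>)) \<partial>lborel)
         \<le> ennreal (K * \<rho> powr - \<delta>)"
    using nn_integral_truncated_kernel[OF assms] by blast
  \<comment> \<open>The factor 2 counts both positions of the point in the ball; the summand 1 makes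
    \<open>C\<close> positive, so that \<open>e / C\<close> is a legitimate target later.\<close>
  define C where "C = 2 * K * V * 2 powr n + 1"
  have "0 < C" using K(1) V by (simp add: C_def add_nonneg_pos)
  moreover have "gagliardo \<delta> G u \<le> ennreal (C * R powr (real DIM('a) - \<delta>))"
    if R: "0 < R" and u: "\<And>x. 0 \<le> u x \<and> u x \<le> 1" "\<And>x. x \<notin> cball a (2 * R) \<Longrightarrow> u x = 0"
      and lip: "\<And>x y. \<bar>u x - u y\<bar> \<le> norm (x - y) / R" for G u R and a :: 'a
  proof -
    define B where "B = cball a (2 * R)"
    have [measurable]: "B \<in> sets borel" by (simp add: B_def)
    define h where "h x y = ennreal (min 1 (norm (x - y) / R) / norm (x - y) powr (n + \<delta>))" for x y :: 'a
    have h_meas [measurable]: "case_prod h \<in> borel_measurable (borel \<Otimes>\<^sub>M borel)"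
      unfolding h_def by measurable
    have h_sym: "h x y = h y x" for x y by (simp add: h_def norm_minus_commute)
    have h_int: "(\<integral>\<^sup>+y. h x y \<partial>lborel) \<le> ennreal (K * R powr - \<delta>)" for x
      using K(2)[OF R] by (simp add: h_def n_def)
    have ptw: "ennreal (\<bar>u x - u y\<bar> / norm (x - y) powr (real DIM('a) + \<delta>))
        \<le> h x y * indicator B x + h y x * indicator B y" for x y
    proof (cases "x \<in> B \<or> y \<in> B")
      case True
      have "\<bar>u x - u y\<bar> \<le> min 1 (norm (x - y) / R)"
        using u(1)[of x] u(1)[of y] lip[of x y] by (auto simp: abs_if)
      then have "ennreal (\<bar>u x - u y\<bar> / norm (x - y) powr (real DIM('a) + \<delta>)) \<le> h x y"
        unfolding h_def n_def by (intro ennreal_leI divide_right_mono) auto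
      also have "\<dots> \<le> h x y * indicator B x + h y x * indicator B y"
        using True h_sym[of x y] by (auto split: split_indicator)
      finally show ?thesis .
    qed (use u(2) in \<open>auto simp: B_def\<close>)
    have "gagliardo \<delta> G u \<le> (\<integral>\<^sup>+x. \<integral>\<^sup>+y. h x y * indicator B x + h y x * indicator B y \<partial>lborel \<partial>lborel)"
      unfolding gagliardo_def
    proof (intro nn_integral_mono)
      fix x :: 'a
      have "(\<integral>\<^sup>+y. ennreal (\<bar>u x - u y\<bar> / norm (x - y) powr (real DIM('a) + \<delta>)) * indicator G y \<partial>lborel)
          * indicator G x
        \<le> (\<integral>\<^sup>+y. ennreal (\<bar>u x - u y\<bar> / norm (x - y) powr (real DIM('a) + \<delta>)) * indicator G y \<partial>lborel)"
        by (auto split: split_indicator)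
      also have "\<dots> \<le> (\<integral>\<^sup>+y. h x y * indicator B x + h y x * indicator B y \<partial>lborel)"
        by (intro nn_integral_mono order_trans[OF _ ptw]) (auto split: split_indicator)
      finally show "(\<integral>\<^sup>+y. ennreal (\<bar>u x - u y\<bar> / norm (x - y) powr (real DIM('a) + \<delta>)) * indicator G y \<partial>lborel)
          * indicator G x \<le> (\<integral>\<^sup>+y. h x y * indicator B x + h y x * indicator B y \<partial>lborel)" .
    qed
    also have "\<dots> = (\<integral>\<^sup>+x. \<integral>\<^sup>+y. h x y * indicator B x \<partial>lborel \<partial>lborel)
        + (\<integral>\<^sup>+x. \<integral>\<^sup>+y. h y x * indicator B y \<partial>lborel \<partial>lborel)"
      by (simp add: nn_integral_add)
    also have "(\<integral>\<^sup>+x. \<integral>\<^sup>+y. h y x * indicator B y \<partial>lborel \<partial>lborel)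
        = (\<integral>\<^sup>+x. \<integral>\<^sup>+y. h x y * indicator B x \<partial>lborel \<partial>lborel)"
      by (rule lborel_pair.Fubini') measurable
    finally have bound: "gagliardo \<delta> G u \<le> (\<integral>\<^sup>+x. \<integral>\<^sup>+y. h x y * indicator B x \<partial>lborel \<partial>lborel)
        + (\<integral>\<^sup>+x. \<integral>\<^sup>+y. h x y * indicator B x \<partial>lborel \<partial>lborel)" .
    have "(\<integral>\<^sup>+x. \<integral>\<^sup>+y. h x y * indicator B x \<partial>lborel \<partial>lborel)
        \<le> (\<integral>\<^sup>+x. ennreal (K * R powr - \<delta>) * indicator B x \<partial>lborel)"
      using h_int by (intro nn_integral_mono) (auto simp: nn_integral_multc split: split_indicator)
    also have "\<dots> = ennreal (K * R powr - \<delta> * (V * (2 * R) powr n))"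
      using R V K(1) by (simp add: nn_integral_cmult_indicator B_def emeasure_cball V_def n_def
          powr_realpow ennreal_mult[symmetric])
    also have "K * R powr - \<delta> * (V * (2 * R) powr n) = K * V * 2 powr n * R powr (n - \<delta>)"
      using R by (simp add: powr_mult powr_add[symmetric] powr_diff powr_minus field_simps)
    finally have half: "(\<integral>\<^sup>+x. \<integral>\<^sup>+y. h x y * indicator B x \<partial>lborel \<partial>lborel)
        \<le> ennreal (K * V * 2 powr n * R powr (n - \<delta>))" .
    have "gagliardo \<delta> G u
        \<le> ennreal (K * V * 2 powr n * R powr (n - \<delta>)) + ennreal (K * V * 2 powr n * R powr (n - \<delta>))"
      by (rule order_trans[OF bound add_mono[OF half half]])
    also have "\<dots> = ennreal (2 * (K * V * 2 powr n * R powr (n - \<delta>)))"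
      using K(1) V by (simp add: ennreal_plus[symmetric] del: ennreal_plus)
    also have "\<dots> \<le> ennreal (C * R powr (n - \<delta>))"
      by (intro ennreal_leI) (simp add: C_def algebra_simps)
    finally show ?thesis by (simp add: n_def)
  qed
  ultimately show thesis using that by blast
qed

section \<open>The continuous competitor and its energy\<close>

theorem theorem3p1:
  fixes G D :: "(real^'n) set" and \<delta> :: real
  assumes "CARD('n) \<ge> 2"
    and "open G"
    and "0 < \<delta>" and "\<delta> < 1"
    and "open D" and "compactly_contained D G"
    and "hausdorff_measure (real CARD('n) - \<delta>) (frontier D) = 0"
  shows "frac_cap \<delta> (closure D) G \<le> 2 * frac_perimeter \<delta> D G"
proof (rule ennreal_le_epsilon)
  fix e :: real assume "0 < e"
  let ?s = "real CARD('n) - \<delta>"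
  have s: "0 < ?s" using assms(1,4) by linarith
  have cD: "compact (closure D)" "closure D \<subseteq> G"
    using assms(6) by (auto simp: compactly_contained_def)
  have cF: "compact (frontier D)" "frontier D \<subseteq> G"
    using cD by (auto simp: frontier_def compact_diff)
  \<comment> \<open>Radii of at most \<open>r / 2\<close> will keep the doubled balls, which carry
    the bumps, inside \<open>G\<close>.\<close>
  obtain r where r: "0 < r" "(\<Union>x\<in>frontier D. cball x r) \<subseteq> G"
    using compact_subset_open_imp_cball_epsilon_subset[OF cF(1) \<open>open G\<close> cF(2)] .
  obtain C where C: "0 < C"
    "\<And>G u R (a :: real^'n). 0 < R \<Longrightarrow> (\<And>x. 0 \<le> u x \<and> u x \<le> 1) \<Longrightarrow>
       (\<And>x. x \<notin> cball a (2 * R) \<Longrightarrow> u x = 0) \<Longrightarrow> (\<And>x y. \<bar>u x - u y\<bar> \<le> norm (x - y) / R) \<Longrightarrow>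
       gagliardo \<delta> G u \<le> ennreal (C * R powr (real DIM(real^'n) - \<delta>))"
    using gagliardo_bump_le[OF assms(3,4)] by blast
  obtain I c R where I: "finite (I :: nat set)"
    and cR: "\<And>i. i \<in> I \<Longrightarrow> c i \<in> frontier D \<and> 0 < R i \<and> R i \<le> r / 2"
    and cover: "frontier D \<subseteq> (\<Union>i\<in>I. ball (c i) (R i))"
    and small: "(\<Sum>i\<in>I. R i powr ?s) \<le> e / C"
    using hausdorff_null_ball_cover[OF cF(1) assms(7) s divide_pos_pos[OF \<open>0 < e\<close> C(1)] half_gt_zero[OF r(1)]]
    by blast
  define w where "w i x = max 0 (min 1 (2 - norm (x - c i) / R i))" for i and x :: "real^'n"
  define u where "u x = min 1 (indicator D x + (\<Sum>i\<in>I. w i x))" for x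
  have w01: "0 \<le> w i x" "w i x \<le> 1" for i x by (auto simp: w_def)
  have w_cont: "continuous_on A (w i)" if "i \<in> I" for A i
    unfolding w_def using cR[OF that] by (intro continuous_intros) auto
  have w_supp: "w i x = 0" if "i \<in> I" "x \<notin> cball (c i) (2 * R i)" for i x
  proof -
    have "0 < R i" "2 * R i \<le> norm (x - c i)" using cR that by (auto simp: dist_norm norm_minus_commute)
    then show ?thesis by (simp add: w_def le_divide_eq)
  qed
  have w_one: "w i x = 1" if "i \<in> I" "x \<in> ball (c i) (R i)" for i x
  proof -
    have "0 < R i" "norm (x - c i) \<le> R i" using cR that by (auto simp: dist_norm norm_minus_commute)
    then show ?thesis by (simp add: w_def divide_le_eq)
  qed
  have w_lip: "\<bar>w i x - w i y\<bar> \<le> norm (x - y) / R i" if "i \<in> I" for i x y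
  proof -
    \<comment> \<open>Clamping to the unit interval does not increase differences.\<close>
    have "\<bar>w i x - w i y\<bar> \<le> \<bar>norm (x - c i) / R i - norm (y - c i) / R i\<bar>"
      unfolding w_def by linarith
    also have "\<dots> = \<bar>norm (x - c i) - norm (y - c i)\<bar> / R i"
      using cR[OF that] by (simp add: diff_divide_distrib[symmetric])
    also have "\<dots> \<le> norm (x - y) / R i"
      using cR[OF that] norm_triangle_ineq3[of "x - c i" "y - c i"] by (intro divide_right_mono) auto
    finally show ?thesis .
  qed
  \<comment> \<open>An open neighbourhood of \<open>closure D\<close> on which \<open>u\<close> is
    constantly 1. Together with the complement of \<open>closure D\<close> it covers the whole space
    by two open sets, so continuity can be checked on each of them.\<close>
  define W where "W = D \<union> (\<Union>i\<in>I. ball (c i) (R i))"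
  have "open W" using \<open>open D\<close> by (auto simp: W_def)
  have DW: "closure D \<subseteq> W"
    using cover closure_Un_frontier[of D] by (auto simp: W_def)
  have u_one: "u x = 1" if x: "x \<in> W" for x
  proof -
    have "1 \<le> indicator D x + (\<Sum>i\<in>I. w i x)"
    proof (cases "x \<in> D")
      case True
      then show ?thesis using w01 by (simp add: sum_nonneg)
    next
      case False
      then obtain i where i: "i \<in> I" "x \<in> ball (c i) (R i)" using x by (auto simp: W_def)
      have "w i x \<le> (\<Sum>i\<in>I. w i x)" using I i(1) w01 by (intro member_le_sum) auto
      then show ?thesis using w_one[OF i] by (simp add: add_increasing)
    qed
    then show ?thesis by (simp add: u_def)
  qed
  have "continuous_on W u"
    by (rule continuous_on_eq[where f = "\<lambda>_. 1"]) (simp_all add: u_one)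
  moreover have "continuous_on (- closure D) u"
  proof -
    \<comment> \<open>Here the indicator vanishes, which leaves only the truncated sum of
      bumps.\<close>
    have "continuous_on (- closure D) (\<lambda>x. min 1 (\<Sum>i\<in>I. w i x))"
      by (intro continuous_intros w_cont)
    moreover have "u x = min 1 (\<Sum>i\<in>I. w i x)" if "x \<in> - closure D" for x
      using that closure_subset[of D] by (auto simp: u_def indicator_def)
    ultimately show ?thesis by (metis (no_types, lifting) continuous_on_eq)
  qed
  ultimately have "continuous_on (W \<union> - closure D) u"
    using \<open>open W\<close> by (intro continuous_on_open_Un) auto
  then have u_cont: "continuous_on G u"
    by (rule continuous_on_subset) (use DW in auto)
  let ?L = "closure D \<union> (\<Union>i\<in>I. cball (c i) (2 * R i))"
  have L: "compact ?L" using I cD by (intro compact_Un compact_UN) auto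
  have "{x \<in> G. u x \<noteq> 0} \<subseteq> ?L"
  proof (rule subsetI, rule ccontr)
    fix x assume x: "x \<in> {x \<in> G. u x \<noteq> 0}" "x \<notin> ?L"
    then have "x \<notin> D" "\<And>i. i \<in> I \<Longrightarrow> w i x = 0" using closure_subset[of D] w_supp by auto
    then show False using x by (simp add: u_def)
  qed
  then have supp: "closure {x \<in> G. u x \<noteq> 0} \<subseteq> ?L"
    using L by (simp add: closure_minimal compact_imp_closed)
  have "cball (c i) (2 * R i) \<subseteq> G" if "i \<in> I" for i
  proof -
    have "cball (c i) (2 * R i) \<subseteq> cball (c i) r" using cR[OF that] by (intro subset_cball) auto
    then show ?thesis using r(2) cR[OF that] by blast
  qed
  then have LG: "?L \<subseteq> G" using cD by blast
  \<comment> \<open>The closure equals its own intersection with the compact set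
    \<open>?L\<close>.\<close>
  have "compact (closure {x \<in> G. u x \<noteq> 0})"
    using compact_Int_closed[OF L closed_closure[of "{x \<in> G. u x \<noteq> 0}"]] unfolding Int_absorb1[OF supp] .
  then have "u \<in> C0 G"
    using u_cont subset_trans[OF supp LG] unfolding C0_def compactly_contained_def by simp
  then have "frac_cap \<delta> (closure D) G \<le> gagliardo \<delta> G u"
    using u_one DW by (intro frac_cap_le_gagliardo) auto
  also have "\<dots> \<le> gagliardo \<delta> G (indicator D) + (\<Sum>i\<in>I. gagliardo \<delta> G (w i))"
  proof (rule gagliardo_le_add_sum)
    fix x y
    \<comment> \<open>Truncation at 1 is a contraction, so it can be removed before the triangle
      inequality.\<close>
    have "\<bar>u x - u y\<bar> \<le> \<bar>(indicator D x + (\<Sum>i\<in>I. w i x)) - (indicator D y + (\<Sum>i\<in>I. w i y))\<bar>"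
      unfolding u_def by linarith
    also have "\<dots> = \<bar>(indicator D x - indicator D y) + (\<Sum>i\<in>I. w i x - w i y)\<bar>"
      by (simp add: sum_subtractf)
    also have "\<dots> \<le> \<bar>indicator D x - indicator D y\<bar> + (\<Sum>i\<in>I. \<bar>w i x - w i y\<bar>)"
      by (intro order_trans[OF abs_triangle_ineq] add_left_mono sum_abs)
    finally show "\<bar>u x - u y\<bar> \<le> \<bar>indicator D x - indicator D y\<bar> + (\<Sum>i\<in>I. \<bar>w i x - w i y\<bar>)" .
  qed (use \<open>open G\<close> \<open>open D\<close> w_cont in \<open>auto intro: borel_measurable_continuous_onI\<close>)
  also have "gagliardo \<delta> G (indicator D) = 2 * frac_perimeter \<delta> D G"
    using \<open>open G\<close> \<open>open D\<close> cD(2) closure_subset[of D] by (intro gagliardo_indicator) auto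
  finally have cap_le: "frac_cap \<delta> (closure D) G
      \<le> 2 * frac_perimeter \<delta> D G + (\<Sum>i\<in>I. gagliardo \<delta> G (w i))" .
  \<comment> \<open>The exponent of the bump estimate is that of the Hausdorff measure, so the
    choice of the cover bounds all bumps together by \<open>e\<close>.\<close>
  have "(\<Sum>i\<in>I. gagliardo \<delta> G (w i)) \<le> (\<Sum>i\<in>I. ennreal (C * R i powr ?s))"
  proof (rule sum_mono)
    fix i assume "i \<in> I"
    then have "gagliardo \<delta> G (w i) \<le> ennreal (C * R i powr (real DIM(real^'n) - \<delta>))"
      using cR w01 w_supp w_lip by (intro C(2)[where a = "c i"]) auto
    then show "gagliardo \<delta> G (w i) \<le> ennreal (C * R i powr ?s)" by simp
  qed
  also have "\<dots> = ennreal (C * (\<Sum>i\<in>I. R i powr ?s))"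
    using C(1) by (simp add: sum_ennreal sum_distrib_left)
  also have "\<dots> \<le> ennreal e"
    using small C(1) by (intro ennreal_leI) (simp add: field_simps)
  finally show "frac_cap \<delta> (closure D) G \<le> 2 * frac_perimeter \<delta> D G + ennreal e"
    by (rule order_trans[OF cap_le add_left_mono])
qed

end
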